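(* Let $G=G_1\times\cdots\times G_m$ be an elementary Abelian group. Then a function $\xi:G\to U(1)$ is quadratic if and only if $$\xi(g)=e^{\pi i\left(g^TMg+C^Tg+2v^Tg\right)}\qquad\text{for all } g\in G,$$ where $C$, $v$, $M$ are, respectively, two vectors and a matrix that satisfy the following: - $v$ is an element of the bullet group $G^\bullet$; - $M$ is the matrix representation of a group homomorphism from $G$ to $G^\bullet$; and - $C$ is an integer vector dependent on $M$, defined component-wise as $C(i)=M(i,i)c_i$, where $c_i$ is the characteristic of the group $G_i$.
   Context: An elementary Abelian group is $G=G_1\times\cdots\times G_m$ where each factor $G_i$ is one of $\mathbb{Z}$, $\mathbb{R}$, $\mathbb{Z}_N=\{0,\dots,N-1\}$ (addition mod $N$), $\mathbb{T}=[0,1)$ (addition mod 1, circle topology). Elements are viewed as real $m$-tuples (column vectors). Characteristics: $\mathrm{char}(\mathbb{Z})=\mathrm{char}(\mathbb{R})=0$, $\mathrm{char}(\mathbb{Z}_N)=N$, $\mathrm{char}(\mathbb{T})=1$. For $x\in\mathbb{R}^m$, $x\equiv g\pmod G$ means $x_i\equiv g_i\pmod{c_i}$ for all $i$ (mod $0$ means equality). The bullet group is $G^\bullet=G_1^\bullet\times\cdots\times G_m^\bullet$ with $\mathbb{Z}_N^\bullet=\{0,\frac1N,\dots,\frac{N-1}{N}\}$ mod $1$, $\mathbb{R}^\bullet=\mathbb{R}$, $\mathbb{Z}^\bullet=\mathbb{T}$, $\mathbb{T}^\bullet=\mathbb{Z}$. Congruence mod $G^\bullet$ is componentwise: mod 1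 in the components $\mathbb{Z}_N^\bullet$ and $\mathbb{Z}^\bullet$, equality in the components $\mathbb{R}^\bullet$ and $\mathbb{T}^\bullet$. A real $m\times m$ matrix $M$ is a matrix representation of a group homomorphism $\varphi:G\to G^\bullet$ if $\varphi(g)\equiv Mx\pmod{G^\bullet}$ for every $g\in G$ and every $x\in\mathbb{R}^m$ with $x\equiv g\pmod G$. A bicharacter of $G$ is a continuous $B:G\times G\to U(1)$ that is a character (continuous homomorphism to $U(1)$) in each argument. A function $\xi:G\to U(1)$ is quadratic if it is continuous and there is a bicharacter $B$ with $\xi(g+h)=\xi(g)\xi(h)B(g,h)$ for all $g,h\in G$.
   Formalization: The matrix M is additionally required to be symmetric; without this the "if" direction fails, e.g. for G=Z_2×Z_2, M=[[0,1/2],[0,0]], C=0, v=0, where ξ(1,1)=i and ξ is not quadratic. *)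

theory Defs
  imports "HOL-Analysis.Analysis" "HOL-Algebra.Group" "HOL-Library.Real_Mod"
begin

datatype factor = Integers | Reals | Cyclic nat | Circle

fun factor_carrier :: "factor \<Rightarrow> real set" where
  "factor_carrier Integers = \<int>"
| "factor_carrier Reals = UNIV"
| "factor_carrier (Cyclic N) = real ` {0..<N}"
| "factor_carrier Circle = {0..<1}"

fun factor_char :: "factor \<Rightarrow> real" where
  "factor_char Integers = 0"
| "factor_char Reals = 0"
| "factor_char (Cyclic N) = real N"
| "factor_char Circle = 1"

text \<open>The circle carries the topology pulled back from the unit circle in the complex plane,
  not the subspace topology of the half-open interval.\<close>

fun factor_topology :: "factor \<Rightarrow> real topology" where
  "factor_topology Integers = top_of_set \<int>"
| "factor_topology Reals = euclidean"
| "factor_topology (Cyclic N) = top_of_set (real ` {0..<N})"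
| "factor_topology Circle = pullback_topology {0..<1} (\<lambda>x. cis (2 * pi * x)) euclidean"

fun bullet_carrier :: "factor \<Rightarrow> real set" where
  "bullet_carrier Integers = {0..<1}"
| "bullet_carrier Reals = UNIV"
| "bullet_carrier (Cyclic N) = (\<lambda>k. real k / real N) ` {0..<N}"
| "bullet_carrier Circle = \<int>"

fun bullet_char :: "factor \<Rightarrow> real" where
  "bullet_char Integers = 1"
| "bullet_char Reals = 0"
| "bullet_char (Cyclic N) = 1"
| "bullet_char Circle = 0"

text \<open>Modulus \<open>0\<close> stands for equality: \<open>x rmod 0 = x\<close>.\<close>

definition residue_product :: "('m \<Rightarrow> real set) \<Rightarrow> ('m \<Rightarrow> real) \<Rightarrow> (real ^ 'm) monoid" where
  "residue_product A c =
     \<lparr>carrier = {x. \<forall>i. x $ i \<in> A i},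
      mult = (\<lambda>x y. \<chi> i. (x $ i + y $ i) rmod c i),
      one = 0\<rparr>"

definition elem_group :: "('m \<Rightarrow> factor) \<Rightarrow> (real ^ 'm) monoid" where
  "elem_group G = residue_product (\<lambda>i. factor_carrier (G i)) (\<lambda>i. factor_char (G i))"

definition bullet_group :: "('m \<Rightarrow> factor) \<Rightarrow> (real ^ 'm) monoid" where
  "bullet_group G = residue_product (\<lambda>i. bullet_carrier (G i)) (\<lambda>i. bullet_char (G i))"

definition group_topology :: "('m::finite \<Rightarrow> factor) \<Rightarrow> (real ^ 'm) topology" where
  "group_topology G =
     pullback_topology UNIV ($) (product_topology (\<lambda>i. factor_topology (G i)) UNIV)"

definition elem_cong :: "('m \<Rightarrow> factor) \<Rightarrow> real ^ 'm \<Rightarrow> real ^ 'm \<Rightarrow> bool" where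
  "elem_cong G x y \<longleftrightarrow> (\<forall>i. [x $ i = y $ i] (rmod factor_char (G i)))"

definition bullet_cong :: "('m \<Rightarrow> factor) \<Rightarrow> real ^ 'm \<Rightarrow> real ^ 'm \<Rightarrow> bool" where
  "bullet_cong G x y \<longleftrightarrow> (\<forall>i. [x $ i = y $ i] (rmod bullet_char (G i)))"

definition matrix_rep ::
    "('m::finite \<Rightarrow> factor) \<Rightarrow> real ^ 'm ^ 'm \<Rightarrow> (real ^ 'm \<Rightarrow> real ^ 'm) \<Rightarrow> bool" where
  "matrix_rep G M \<phi> \<longleftrightarrow>
     (\<forall>g \<in> carrier (elem_group G). \<forall>x. elem_cong G x g \<longrightarrow> bullet_cong G (\<phi> g) (M *v x))"

definition U1 :: "complex monoid" where
  "U1 = \<lparr>carrier = sphere 0 1, mult = (*), one = 1\<rparr>"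

definition is_character :: "('m::finite \<Rightarrow> factor) \<Rightarrow> (real ^ 'm \<Rightarrow> complex) \<Rightarrow> bool" where
  "is_character G f \<longleftrightarrow>
     f \<in> hom (elem_group G) U1 \<and>
     continuous_map (group_topology G) (top_of_set (carrier U1)) f"

definition bicharacter ::
    "('m::finite \<Rightarrow> factor) \<Rightarrow> (real ^ 'm \<Rightarrow> real ^ 'm \<Rightarrow> complex) \<Rightarrow> bool" where
  "bicharacter G B \<longleftrightarrow>
     continuous_map (prod_topology (group_topology G) (group_topology G))
       (top_of_set (carrier U1)) (\<lambda>(g, h). B g h) \<and>
     (\<forall>h \<in> carrier (elem_group G). is_character G (\<lambda>g. B g h)) \<and>
     (\<forall>g \<in> carrier (elem_group G). is_character G (\<lambda>h. B g h))"

definition quadratic :: "('m::finite \<Rightarrow> factor) \<Rightarrow> (real ^ 'm \<Rightarrow> complex) \<Rightarrow> bool" where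
  "quadratic G \<xi> \<longleftrightarrow>
     continuous_map (group_topology G) (top_of_set (carrier U1)) \<xi> \<and>
     (\<exists>B. bicharacter G B \<and>
        (\<forall>g \<in> carrier (elem_group G). \<forall>h \<in> carrier (elem_group G).
           \<xi> (g \<otimes>\<^bsub>elem_group G\<^esub> h) = \<xi> g * \<xi> h * B g h))"

lemma comm_group_residue_product:
  assumes zero: "\<And>i. 0 \<in> A i"
    and add: "\<And>i x y. x \<in> A i \<Longrightarrow> y \<in> A i \<Longrightarrow> (x + y) rmod c i \<in> A i"
    and minus: "\<And>i x. x \<in> A i \<Longrightarrow> (- x) rmod c i \<in> A i"
    and red: "\<And>i x. x \<in> A i \<Longrightarrow> x rmod c i = x"
  shows "comm_group (residue_product A c)"
proof (rule comm_groupI)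
  have add3: "(x rmod m + y) rmod m = (x + y) rmod m" for x y m :: real
    by (metis rmod_add rmod_rmod)
  show "x \<otimes>\<^bsub>residue_product A c\<^esub> y \<otimes>\<^bsub>residue_product A c\<^esub> z =
        x \<otimes>\<^bsub>residue_product A c\<^esub> (y \<otimes>\<^bsub>residue_product A c\<^esub> z)" for x y z
    by (simp add: residue_product_def vec_eq_iff add3 add.commute[of "x $ _" "(_ :: real) rmod _"])
      (simp add: add_ac)
  show "\<exists>y \<in> carrier (residue_product A c). y \<otimes>\<^bsub>residue_product A c\<^esub> x = \<one>\<^bsub>residue_product A c\<^esub>"
    if "x \<in> carrier (residue_product A c)" for x
    using that minus
    by (intro bexI[of _ "\<chi> i. (- x $ i) rmod c i"]) (auto simp: residue_product_def vec_eq_iff add3)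
qed (use assms in \<open>auto simp: residue_product_def vec_eq_iff add.commute\<close>)

lemma rmod_in_Ints: "x \<in> \<int> \<Longrightarrow> x rmod real N \<in> \<int>"
  by (simp add: rmod_def)

lemma rmod_real_in_cyclic:
  assumes "x \<in> \<int>" "N > 0"
  shows "x rmod real N \<in> real ` {0..<N}"
proof -
  obtain k where k: "x rmod real N = of_int k"
    using rmod_in_Ints[OF assms(1)] by (auto elim: Ints_cases)
  have "0 \<le> x rmod real N" "x rmod real N < real N"
    using assms(2) by (auto simp: rmod_nonneg rmod_less)
  with k have "0 \<le> k" "k < int N" by auto
  then show ?thesis
    using k by (intro image_eqI[of _ _ "nat k"]) auto
qed

lemma comm_group_elem_group:
  assumes "\<And>i N. G i = Cyclic N \<Longrightarrow> N > 0"
  shows "comm_group (elem_group G)"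
  unfolding elem_group_def
proof (rule comm_group_residue_product)
  fix i
  show "0 \<in> factor_carrier (G i)" using assms[of i] by (cases "G i") auto
  show "(x + y) rmod factor_char (G i) \<in> factor_carrier (G i)"
    if "x \<in> factor_carrier (G i)" "y \<in> factor_carrier (G i)" for x y
    using assms[of i] that
    by (cases "G i") (auto simp: rmod_nonneg rmod_less intro!: rmod_real_in_cyclic)
  show "(- x) rmod factor_char (G i) \<in> factor_carrier (G i)"
    if "x \<in> factor_carrier (G i)" for x
    using assms[of i] that
    by (cases "G i") (auto simp: rmod_nonneg rmod_less intro!: rmod_real_in_cyclic)
  show "x rmod factor_char (G i) = x" if "x \<in> factor_carrier (G i)" for x
    using that by (cases "G i") auto
qed

lemma rmod_1_in_bullet_cyclic:
  assumes "x * real N \<in> \<int>" "N > 0"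
  shows "x rmod 1 \<in> (\<lambda>k. real k / real N) ` {0..<N}"
proof -
  have "(x * real N) rmod real N \<in> real ` {0..<N}"
    using assms by (rule rmod_real_in_cyclic)
  moreover have "(x * real N) rmod real N = (x rmod 1) * real N"
    using assms(2) by (simp add: rmod_def algebra_simps)
  ultimately show ?thesis
    using assms(2) by (auto simp: field_simps image_iff)
qed

lemma comm_group_bullet_group:
  assumes "\<And>i N. G i = Cyclic N \<Longrightarrow> N > 0"
  shows "comm_group (bullet_group G)"
  unfolding bullet_group_def
proof (rule comm_group_residue_product)
  fix i
  show "0 \<in> bullet_carrier (G i)" using assms[of i] by (cases "G i") (auto simp: image_iff)
  show "(x + y) rmod bullet_char (G i) \<in> bullet_carrier (G i)"
    if "x \<in> bullet_carrier (G i)" "y \<in> bullet_carrier (G i)" for x y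
    using assms[of i] that
    by (cases "G i")
      (auto simp: rmod_nonneg rmod_less distrib_right simp del: bullet_carrier.simps(3)
            intro!: rmod_1_in_bullet_cyclic, auto simp: distrib_right intro!: rmod_1_in_bullet_cyclic)
  show "(- x) rmod bullet_char (G i) \<in> bullet_carrier (G i)"
    if "x \<in> bullet_carrier (G i)" for x
    using assms[of i] that
    by (cases "G i") (auto simp: rmod_nonneg rmod_less intro!: rmod_1_in_bullet_cyclic)
  show "x rmod bullet_char (G i) = x" if "x \<in> bullet_carrier (G i)" for x
    using that by (cases "G i") auto
qed

lemma topspace_group_topology: "topspace (group_topology G) = carrier (elem_group G)"
proof -
  have "topspace (factor_topology f) = factor_carrier f" for f
    by (cases f) (auto simp: topspace_pullback_topology)
  then show ?thesis
    by (auto simp: group_topology_def elem_group_def residue_product_def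
        topspace_pullback_topology PiE_def Pi_def)
qed

end

theory Submission
  imports Defs
begin

text \<open>
  Everything is lifted from \<open>G\<close> to its cover \<open>L\<close>, a product of copies of \<open>\<int>\<close> and \<open>\<real>\<close>, of which
  \<open>G\<close> is the quotient by the group \<open>K\<close> of periods. With \<open>e(t) = exp (2 \<pi> i t)\<close>, every character
  of \<open>L\<close> is \<open>x \<mapsto> e(v \<bullet> x)\<close> and every symmetric bicharacter is \<open>(x, y) \<mapsto> e(x \<bullet> M y)\<close> with \<open>M\<close>
  symmetric. Such an \<open>M\<close> represents a homomorphism from \<open>G\<close> to its bullet group iff \<open>k \<bullet> M x\<close> is an
  integer for \<open>k \<in> K\<close> and \<open>x \<in> L\<close>, that is, iff the bicharacter descends to \<open>G\<close>. The vector \<open>C\<close>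
  makes the Gaussian of \<open>M\<close> invariant under \<open>K\<close>, so a quadratic function with this bicharacter
  is the Gaussian times a character of \<open>G\<close>, which gives \<open>v\<close>. Continuity on \<open>G\<close> of an invariant
  continuous function follows from local sections of \<open>L \<rightarrow> G\<close>.
\<close>

section \<open>The exponential of period one\<close>

definition unit_exp :: "real \<Rightarrow> complex" where
  "unit_exp t = cis (2 * pi * t)"

lemma unit_exp_0 [simp]: "unit_exp 0 = 1"
  by (simp add: unit_exp_def)

lemma unit_exp_add: "unit_exp (s + t) = unit_exp s * unit_exp t"
  by (simp add: unit_exp_def cis_mult distrib_left)

lemma unit_exp_minus: "unit_exp (- t) = inverse (unit_exp t)"
  by (simp add: unit_exp_def)

lemma norm_unit_exp [simp]: "norm (unit_exp t) = 1"
  by (simp add: unit_exp_def)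

lemma unit_exp_nonzero [simp]: "unit_exp t \<noteq> 0"
  by (simp add: unit_exp_def)

lemma unit_exp_sum: "unit_exp (\<Sum>i\<in>I. t i) = (\<Prod>i\<in>I. unit_exp (t i))"
  by (induction I rule: infinite_finite_induct) (auto simp: unit_exp_add)

lemma unit_exp_eq_1_iff: "unit_exp t = 1 \<longleftrightarrow> t \<in> \<int>"
  by (auto simp: unit_exp_def cis_eq_1_iff elim!: Ints_cases)

lemma unit_exp_eq_iff: "unit_exp s = unit_exp t \<longleftrightarrow> s - t \<in> \<int>"
proof -
  have "unit_exp s = unit_exp (s - t) * unit_exp t" by (simp flip: unit_exp_add)
  then have "unit_exp s = unit_exp t \<longleftrightarrow> unit_exp (s - t) = 1" by simp
  then show ?thesis by (simp only: unit_exp_eq_1_iff)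
qed

lemma continuous_on_unit_exp [continuous_intros]:
  "continuous_on S f \<Longrightarrow> continuous_on S (\<lambda>x. unit_exp (f x))"
  unfolding unit_exp_def by (intro continuous_intros)

section \<open>Characters of the integers and of the real line\<close>

lemma all_multiples_Ints_imp_zero:
  fixes a :: real
  assumes "\<And>x. a * x \<in> \<int>"
  shows "a = 0"
proof (rule ccontr)
  assume "a \<noteq> 0"
  with assms[of "1 / (2 * a)"] have "(1/2 :: real) \<in> \<int>" by simp
  then show False by auto
qed

lemma norm_one_eq_unit_exp:
  assumes "norm z = 1"
  obtains v where "z = unit_exp v"
proof -
  have "z = cis (Arg z)"
    using assms cis_Arg[of z] by (cases "z = 0") (auto simp: sgn_div_norm)
  then show ?thesis by (intro that[of "Arg z / (2 * pi)"]) (simp add: unit_exp_def)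
qed

text \<open>Cauchy's functional equation: additivity gives the formula at rational arguments, and
  the set where two continuous functions agree is closed, so density of \<rat> finishes.\<close>

lemma continuous_additive_real:
  fixes h :: "real \<Rightarrow> real"
  assumes cont: "continuous_on UNIV h" and add: "\<And>x y. h (x + y) = h x + h y"
  shows "h x = h 1 * x"
proof -
  interpret additive h by standard (rule add)
  have nat: "h (of_nat n * x) = of_nat n * h x" for n x
    by (induction n) (auto simp: zero add distrib_right)
  have int: "h (of_int k * x) = of_int k * h x" for k x
    by (cases k rule: int_cases2) (auto simp: nat minus)
  have rat: "h q = h 1 * q" if rat: "q \<in> \<rat>" for q
  proof -
    obtain a b where q: "b > 0" "coprime a b" "q = of_int a / of_int b"
      using rat by (rule Rats_cases')
    have "of_int b * h q = of_int a * h 1"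
      using int[of b q] int[of a 1] q by simp
    also have "\<dots> = of_int b * (h 1 * q)" using q by simp
    finally show ?thesis using q(1) by simp
  qed
  have "closed {x. h x = h 1 * x}"
    by (intro closed_Collect_eq continuous_intros cont)
  moreover have "\<rat> \<subseteq> {x. h x = h 1 * x}" using rat by blast
  ultimately have "closure \<rat> \<subseteq> {x. h x = h 1 * x}" by (rule closure_minimal[rotated])
  then show ?thesis unfolding Rats_closure_real by blast
qed

text \<open>The line is contractible, so \<open>f\<close> has a continuous logarithm. Its imaginary
  part, suitably scaled, is additive up to a continuous integer-valued error, which connectedness
  makes constant. Cauchy's equation then gives the frequency \<open>v\<close>.\<close>

lemma real_character:
  fixes f :: "real \<Rightarrow> complex"
  assumes cont: "continuous_on UNIV f" and norm: "\<And>x. norm (f x) = 1"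
    and add: "\<And>x y. f (x + y) = f x * f y"
  obtains v where "\<And>x. f x = unit_exp (v * x)"
proof -
  obtain g where g: "continuous_on UNIV g" "\<And>x. f x = exp (g x)"
    using continuous_logarithm_on_contractible[OF cont convex_imp_contractible[OF convex_UNIV]] norm
    by (metis UNIV_I norm_zero zero_neq_one)
  have "f 0 * f 0 = f 0 * 1" using add[of 0 0] by simp
  then have f0: "f 0 = 1" using norm[of 0] by (subst (asm) mult_cancel_left) auto
  define u where "u x = Im (g x) / (2 * pi)" for x
  \<comment> \<open>Since \<open>f 0 = 1\<close>, the number \<open>u 0\<close> is an integer:
    subtracting it leaves the exponential unchanged and gives \<open>h 0 = 0\<close>.\<close>
  define h where "h x = u x - u 0" for x
  have fu: "f x = unit_exp (u x)" for x
  proof -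
    have "Re (g x) = 0" using norm[of x] g(2)[of x] by simp
    then show ?thesis by (simp add: g(2) unit_exp_def u_def exp_eq_polar)
  qed
  have "u 0 \<in> \<int>" using fu[of 0] f0 unit_exp_eq_1_iff by simp
  then have fh: "f x = unit_exp (h x)" for x
    unfolding h_def fu unit_exp_eq_iff by simp
  have conth: "continuous_on UNIV h"
    unfolding h_def u_def by (intro continuous_intros g(1)) auto
  have hadd: "h (x + y) = h x + h y" for x y
  proof -
    \<comment> \<open>With \<open>y\<close> fixed, the additivity defect is integer-valued, so
      distinct values are at least 1 apart and continuity makes it constant. At 0 it equals
      \<open>- h 0\<close>, which is 0.\<close>
    define D where "D x = h (x + y) - h x - h y" for x
    have int: "D x \<in> \<int>" for x
    proof -
      have "unit_exp (h (x + y)) = unit_exp (h x + h y)"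
        using add[of x y] by (simp add: fh unit_exp_add)
      then show ?thesis by (simp add: unit_exp_eq_iff D_def algebra_simps)
    qed
    have "D constant_on UNIV"
    proof (rule continuous_discrete_range_constant)
      show "continuous_on UNIV D"
        unfolding D_def by (intro continuous_intros continuous_on_compose2[OF conth]) auto
      show "\<exists>e>0. \<forall>z. z \<in> UNIV \<and> D z \<noteq> D x \<longrightarrow> e \<le> norm (D z - D x)" for x
      proof (intro exI[of _ 1] conjI allI impI)
        fix z assume "z \<in> UNIV \<and> D z \<noteq> D x"
        then show "1 \<le> norm (D z - D x)"
          using Ints_nonzero_abs_ge1[of "D z - D x"] int[of z] int[of x] by auto
      qed auto
    qed auto
    then have "D x = D 0" unfolding constant_on_def by auto
    then show ?thesis by (simp add: D_def h_def)
  qed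
  show thesis
  proof (rule that)
    show "f x = unit_exp (h 1 * x)" for x
      unfolding fh by (rule arg_cong[where f = unit_exp]) (rule continuous_additive_real[where h = h, OF conth hadd])
  qed
qed

lemma multiplicative_on_Ints:
  fixes f :: "real \<Rightarrow> complex"
  assumes add: "\<And>x y. x \<in> \<int> \<Longrightarrow> y \<in> \<int> \<Longrightarrow> f (x + y) = f x * f y"
    and 1: "f 1 = unit_exp v" and x: "x \<in> \<int>"
  shows "f x = unit_exp (v * x)"
proof -
  have "f 0 * f 1 = f 1" using add[OF Ints_0 Ints_1] unfolding add_0 by (rule sym)
  then have f0: "f 0 = 1" using 1 by simp
  have nat: "f (of_nat n) = unit_exp (v * of_nat n)" for n
    by (induction n) (auto simp: f0 1 add distrib_left unit_exp_add)
  obtain k where k: "x = of_int k" using x by (elim Ints_cases)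
  show ?thesis
  proof (cases k rule: int_cases2)
    case (nonneg n)
    with k nat show ?thesis by simp
  next
    case (nonpos n)
    have "f (- of_nat n) * f (of_nat n) = 1" using add[of "- of_nat n" "of_nat n"] f0 by simp
    then show ?thesis
      using nat[of n] k nonpos by (simp add: unit_exp_minus field_simps)
  qed
qed

section \<open>Splitting a character along the coordinate axes\<close>

lemma axis_add: "axis i (x + y) = axis i x + axis i (y :: 'a::comm_monoid_add)"
  by (simp add: vec_eq_iff axis_def)

text \<open>Build \<open>x\<close> from its axis components one coordinate at a time. The sets
  \<open>A i\<close> are left general because the lemma is applied both to the cover and to the
  group of periods.\<close>

lemma multiplicative_prod_axis:
  fixes f :: "real ^ 'm::finite \<Rightarrow> complex"
  assumes add: "\<And>x y. \<forall>i. x $ i \<in> A i \<Longrightarrow> \<forall>i. y $ i \<in> A i \<Longrightarrow> f (x + y) = f x * f y"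
    and zero: "\<And>i. 0 \<in> A i" and one: "f 0 = 1" and x: "\<And>i. x $ i \<in> A i"
  shows "f x = (\<Prod>i\<in>UNIV. f (axis i (x $ i)))"
proof -
  have "f (\<chi> i. if i \<in> I then x $ i else 0) = (\<Prod>i\<in>I. f (axis i (x $ i)))" for I
  proof (induction I rule: infinite_finite_induct)
    case (insert j I)
    have "(\<chi> i. if i \<in> insert j I then x $ i else 0) =
          axis j (x $ j) + (\<chi> i. if i \<in> I then x $ i else 0)"
      using insert by (auto simp: vec_eq_iff axis_def)
    also have "f \<dots> = f (axis j (x $ j)) * f (\<chi> i. if i \<in> I then x $ i else 0)"
      using x zero by (intro add) (auto simp: axis_def)
    finally show ?case using insert by simp
  qed (auto simp: one zero_vec_def[symmetric])
  from this[of UNIV] show ?thesis by simp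
qed

section \<open>The cover, its periods and the reduction onto \<open>G\<close>\<close>

fun factor_cover :: "factor \<Rightarrow> real set" where
  "factor_cover Integers = \<int>"
| "factor_cover Reals = UNIV"
| "factor_cover (Cyclic N) = \<int>"
| "factor_cover Circle = UNIV"

definition cover :: "('m \<Rightarrow> factor) \<Rightarrow> (real ^ 'm) set" where
  "cover G = {x. \<forall>i. x $ i \<in> factor_cover (G i)}"

text \<open>This is the kernel of \<open>reduce\<close>. Only coordinates of nonzero characteristic
  contribute; in the others a period is 0.\<close>

definition period :: "('m \<Rightarrow> factor) \<Rightarrow> (real ^ 'm) set" where
  "period G = {x. \<forall>i. \<exists>n::int. x $ i = of_int n * factor_char (G i)}"

definition reduce :: "('m \<Rightarrow> factor) \<Rightarrow> real ^ 'm \<Rightarrow> real ^ 'm" where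
  "reduce G x = (\<chi> i. x $ i rmod factor_char (G i))"

lemma factor_cover_cases:
  obtains "factor_cover F = \<int>" | "factor_cover F = UNIV"
  by (cases F) auto

lemma zero_in_factor_cover [simp]: "0 \<in> factor_cover F"
  and one_in_factor_cover [simp]: "1 \<in> factor_cover F"
  by (cases F; simp)+

lemma factor_cover_add:
  "x \<in> factor_cover F \<Longrightarrow> y \<in> factor_cover F \<Longrightarrow> x + y \<in> factor_cover F"
  by (cases F) auto

lemma factor_char_Ints: "factor_char F \<in> \<int>"
  by (cases F) auto

lemma Ints_subset_factor_cover: "x \<in> \<int> \<Longrightarrow> x \<in> factor_cover F"
  by (cases F) auto

lemma cover_add: "x \<in> cover G \<Longrightarrow> y \<in> cover G \<Longrightarrow> x + y \<in> cover G"
  by (auto simp: cover_def factor_cover_add)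

lemma cover_zero [simp]: "0 \<in> cover G"
  by (auto simp: cover_def)

lemma cover_axis: "x \<in> factor_cover (G i) \<Longrightarrow> axis i x \<in> cover G"
  by (auto simp: cover_def axis_def)

lemma period_zero [simp]: "0 \<in> period G"
  by (auto simp: period_def intro: exI[of _ 0])

lemma period_axis: "axis i (of_int n * factor_char (G i)) \<in> period G"
  by (auto simp: period_def axis_def intro: exI[of _ 0])

lemma period_minus:
  assumes "x \<in> period G"
  shows "- x \<in> period G"
  unfolding period_def
proof safe
  fix i
  obtain n :: int where "x $ i = of_int n * factor_char (G i)"
    using assms unfolding period_def by blast
  then show "\<exists>n::int. (- x) $ i = of_int n * factor_char (G i)"
    by (intro exI[of _ "- n"]) simp
qed

lemma period_subset_cover: "x \<in> period G \<Longrightarrow> x \<in> cover G"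
  unfolding cover_def
proof safe
  fix i assume "x \<in> period G"
  then obtain n :: int where "x $ i = of_int n * factor_char (G i)" unfolding period_def by blast
  then show "x $ i \<in> factor_cover (G i)"
    using Ints_mult[OF Ints_of_int[of n] factor_char_Ints[of "G i"]]
    by (simp add: Ints_subset_factor_cover)
qed

text \<open>Reduction modulo 0 is the identity and 0 is the only multiple of 0, so one congruence
  criterion covers every kind of factor.\<close>

lemma reduce_eq_iff: "reduce G x = reduce G y \<longleftrightarrow> x - y \<in> period G"
proof -
  have "[a = b] (rmod c) \<longleftrightarrow> (\<exists>n::int. a - b = of_int n * c)" for a b c :: real
    by (subst rcong_sym_iff, subst rcong_altdef) (auto simp: algebra_simps)
  then show ?thesis
    by (auto simp: reduce_def period_def vec_eq_iff rcong_def)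
qed

lemma reduce_reduce [simp]: "reduce G (reduce G x) = reduce G x"
  by (simp add: reduce_def vec_eq_iff)

lemma reduce_diff_period: "reduce G x - x \<in> period G"
  unfolding reduce_eq_iff[symmetric] by simp

lemma elem_cong_iff: "elem_cong G x y \<longleftrightarrow> x - y \<in> period G"
  unfolding reduce_eq_iff[symmetric] by (simp add: elem_cong_def rcong_def reduce_def vec_eq_iff)

lemma elem_group_mult: "g \<otimes>\<^bsub>elem_group G\<^esub> h = reduce G (g + h)"
  by (simp add: elem_group_def residue_product_def reduce_def)

lemma carrier_elem_group: "x \<in> carrier (elem_group G) \<longleftrightarrow> (\<forall>i. x $ i \<in> factor_carrier (G i))"
  by (simp add: elem_group_def residue_product_def)

lemma carrier_subset_cover: "x \<in> carrier (elem_group G) \<Longrightarrow> x \<in> cover G"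
  unfolding carrier_elem_group cover_def
proof safe
  fix i assume "\<forall>i. x $ i \<in> factor_carrier (G i)"
  then have "x $ i \<in> factor_carrier (G i)" ..
  then show "x $ i \<in> factor_cover (G i)" by (cases "G i") auto
qed

lemma reduce_carrier: "x \<in> carrier (elem_group G) \<Longrightarrow> reduce G x = x"
  unfolding carrier_elem_group reduce_def vec_eq_iff
proof safe
  fix i assume "\<forall>i. x $ i \<in> factor_carrier (G i)"
  then have "x $ i \<in> factor_carrier (G i)" ..
  then show "(\<chi> i. x $ i rmod factor_char (G i)) $ i = x $ i" by (cases "G i") auto
qed

lemma reduce_add: "reduce G (x + y) = reduce G x \<otimes>\<^bsub>elem_group G\<^esub> reduce G y"
  by (simp add: elem_group_mult reduce_def vec_eq_iff rmod_add)

section \<open>Duality between cover factors and bullet factors\<close>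

lemma bullet_carrier_char: "z \<in> bullet_carrier F \<Longrightarrow> factor_char F * z \<in> \<int>"
  by (cases F) auto

lemma bullet_cong_char: "[z = w] (rmod bullet_char F) \<Longrightarrow> factor_char F * (z - w) \<in> \<int>"
  unfolding rcong_altdef by (cases F) auto

text \<open>Pairing integrally with the whole line forces \<open>z = 0\<close>, which is congruence
  modulo 0; pairing integrally with \<int> forces \<open>z\<close> to be an integer, which is
  congruence modulo 1. These are the bullet characteristics of the respective factors.\<close>

lemma bullet_cong_if_dual:
  assumes "\<And>l. l \<in> factor_cover F \<Longrightarrow> l * z \<in> \<int>"
  shows "[z = 0] (rmod bullet_char F)"
proof (cases "factor_cover F = UNIV")
  case True
  then have "z = 0" using assms by (intro all_multiples_Ints_imp_zero) (auto simp: mult.commute)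
  then show ?thesis by simp
next
  case False
  then have "bullet_char F = 1" by (cases F) auto
  moreover obtain n where "z = of_int n" using assms[of 1] by (auto elim: Ints_cases)
  ultimately show ?thesis unfolding rcong_altdef by (auto intro: exI[of _ "- n"])
qed

text \<open>Converse of the previous duality. It later allows a frequency to be reduced into the
  bullet group without changing its character.\<close>

lemma dual_if_bullet_cong:
  assumes "[z = w] (rmod bullet_char F)" "l \<in> factor_cover F"
  shows "l * (z - w) \<in> \<int>"
proof -
  obtain n where "w = z + of_int n * bullet_char F" using assms(1) unfolding rcong_altdef by blast
  then show ?thesis using assms(2) by (cases F) auto
qed

text \<open>The condition says that the bicharacter \<open>unit_exp (x \<bullet> (M *v y))\<close>
  of the cover is trivial when its first argument is a period; for symmetric \<open>M\<close> the
  same follows for the second.\<close>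

definition integral_on_period :: "('m::finite \<Rightarrow> factor) \<Rightarrow> real ^ 'm ^ 'm \<Rightarrow> bool" where
  "integral_on_period G M \<longleftrightarrow> (\<forall>k\<in>period G. \<forall>x\<in>cover G. k \<bullet> (M *v x) \<in> \<int>)"

lemma inner_symmetric_matrix:
  fixes M :: "real ^ 'm ^ 'm::finite"
  assumes "transpose M = M"
  shows "x \<bullet> (M *v y) = y \<bullet> (M *v x)"
proof -
  have "x \<bullet> (M *v y) = (x v* M) \<bullet> y" by (simp add: dot_lmul_matrix)
  also have "x v* M = M *v x" using transpose_matrix_vector[of M x] assms by simp
  finally show ?thesis by (simp only: inner_commute)
qed

lemma inner_axis_left: "axis i a \<bullet> (x :: real ^ 'm::finite) = a * x $ i"
  by (simp add: inner_axis')

lemma period_inner_Ints: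
  fixes G :: "'m::finite \<Rightarrow> factor"
  assumes "k \<in> period G" "\<And>i. factor_char (G i) * z $ i \<in> \<int>"
  shows "k \<bullet> z \<in> \<int>"
  unfolding inner_vec_def
proof (rule Ints_sum)
  fix i
  obtain n :: int where "k $ i = of_int n * factor_char (G i)"
    using assms(1) unfolding period_def by auto
  then have "k $ i \<bullet> z $ i = of_int n * (factor_char (G i) * z $ i)" by simp
  also have "\<dots> \<in> \<int>" using assms(2)[of i] by (rule Ints_mult[OF Ints_of_int])
  finally show "k $ i \<bullet> z $ i \<in> \<int>" .
qed

text \<open>The assumption excludes \<open>Cyclic 0\<close>, whose carrier is empty, so that
  reduction lands in the carrier.\<close>

locale valid_factors =
  fixes G :: "'m::finite \<Rightarrow> factor"
  assumes pos: "\<And>i N. G i = Cyclic N \<Longrightarrow> N \<ge> 1"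
begin

lemma rmod_in_factor_carrier:
  assumes "x \<in> factor_cover (G i)"
  shows "x rmod factor_char (G i) \<in> factor_carrier (G i)"
proof (cases "G i")
  case (Cyclic N)
  then show ?thesis
    using assms pos[OF Cyclic] rmod_real_in_cyclic[of x N] by simp
qed (use assms in \<open>auto simp: rmod_nonneg rmod_less\<close>)

lemma reduce_in_carrier: "x \<in> cover G \<Longrightarrow> reduce G x \<in> carrier (elem_group G)"
  unfolding carrier_elem_group reduce_def cover_def by (auto intro: rmod_in_factor_carrier)

lemma rmod_in_bullet_carrier:
  assumes "factor_char (G i) * z \<in> \<int>"
  shows "z rmod bullet_char (G i) \<in> bullet_carrier (G i)"
proof (cases "G i")
  case (Cyclic N)
  then show ?thesis
    using assms pos[OF Cyclic] rmod_1_in_bullet_cyclic[of z N] by (simp add: mult.commute)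
qed (use assms in \<open>auto simp: rmod_nonneg rmod_less\<close>)

text \<open>Forward: values of the homomorphism become integral when multiplied by the
  characteristics, and bullet congruence preserves this, so \<open>M *v x\<close> pairs integrally
  with periods. Backward: reduce \<open>M *v g\<close> coordinatewise; symmetry moves a period
  across \<open>M\<close>, so \<open>M\<close> sends periods to vectors that are bullet-congruent to
  0.\<close>

lemma matrix_rep_iff:
  assumes sym: "transpose M = M"
  shows "(\<exists>\<phi> \<in> hom (elem_group G) (bullet_group G). matrix_rep G M \<phi>) \<longleftrightarrow>
    integral_on_period G M"
proof
  assume "\<exists>\<phi> \<in> hom (elem_group G) (bullet_group G). matrix_rep G M \<phi>"
  then obtain \<phi> where \<phi>: "\<phi> \<in> hom (elem_group G) (bullet_group G)" "matrix_rep G M \<phi>" by blast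
  show "integral_on_period G M"
    unfolding integral_on_period_def
  proof (intro ballI)
    fix k x assume k: "k \<in> period G" and x: "x \<in> cover G"
    define g where "g = reduce G x"
    have g: "g \<in> carrier (elem_group G)" unfolding g_def by (rule reduce_in_carrier[OF x])
    have "x - g \<in> period G"
      unfolding g_def using period_minus[OF reduce_diff_period, of G x] by simp
    then have "bullet_cong G (\<phi> g) (M *v x)"
      using \<phi>(2) g unfolding matrix_rep_def elem_cong_iff by blast
    moreover have "\<phi> g $ i \<in> bullet_carrier (G i)" for i
      using \<phi>(1) g by (auto simp: hom_def bullet_group_def residue_product_def)
    ultimately have "factor_char (G i) * (\<phi> g $ i - (M *v x) $ i) \<in> \<int>"
      "factor_char (G i) * \<phi> g $ i \<in> \<int>" for i
      by (auto simp: bullet_cong_def bullet_cong_char bullet_carrier_char)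
    then have "factor_char (G i) * (M *v x) $ i \<in> \<int>" for i
      using Ints_diff[of "factor_char (G i) * \<phi> g $ i"
          "factor_char (G i) * (\<phi> g $ i - (M *v x) $ i)"] by (simp add: algebra_simps)
    then show "k \<bullet> (M *v x) \<in> \<int>" by (rule period_inner_Ints[OF k])
  qed
next
  assume int: "integral_on_period G M"
  have cong: "[(M *v x) $ i = (M *v y) $ i] (rmod bullet_char (G i))"
    if "x - y \<in> period G" for x y i
  proof -
    have "[(M *v x) $ i - (M *v y) $ i = 0] (rmod bullet_char (G i))"
    proof (rule bullet_cong_if_dual)
      fix l assume "l \<in> factor_cover (G i)"
      then have "(x - y) \<bullet> (M *v axis i l) \<in> \<int>"
        using int that cover_axis unfolding integral_on_period_def by blast
      then have "axis i l \<bullet> (M *v (x - y)) \<in> \<int>"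
        using inner_symmetric_matrix[OF sym] by metis
      then show "l * ((M *v x) $ i - (M *v y) $ i) \<in> \<int>"
        by (simp add: inner_axis_left matrix_vector_mult_diff_distrib)
    qed
    then show ?thesis by (simp add: rcong_conv_diff_rmod_eq_0)
  qed
  define \<phi> where "\<phi> g = (\<chi> i. (M *v g) $ i rmod bullet_char (G i))" for g
  have "\<phi> g \<in> carrier (bullet_group G)" if "g \<in> carrier (elem_group G)" for g
  proof -
    \<comment> \<open>The generating period on axis \<open>i\<close> picks out the characteristic
      times one coordinate of \<open>M *v g\<close>, which is the test for membership in the bullet
      carrier.\<close>
    have "axis i (factor_char (G i)) \<bullet> (M *v g) \<in> \<int>" for i
      using int carrier_subset_cover[OF that] period_axis[of i 1 G]
      unfolding integral_on_period_def by simp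
    then show ?thesis
      by (auto simp: \<phi>_def bullet_group_def residue_product_def inner_axis_left
          intro!: rmod_in_bullet_carrier)
  qed
  moreover have "\<phi> (g \<otimes>\<^bsub>elem_group G\<^esub> h) = \<phi> g \<otimes>\<^bsub>bullet_group G\<^esub> \<phi> h" for g h
    using cong[OF reduce_diff_period, of "g + h"]
    by (simp add: \<phi>_def elem_group_mult bullet_group_def residue_product_def vec_eq_iff
        rmod_add rcong_def matrix_vector_mult_add_rdistrib matrix_vector_right_distrib)
  ultimately have "\<phi> \<in> hom (elem_group G) (bullet_group G)" by (simp add: hom_def)
  moreover have "matrix_rep G M \<phi>"
    unfolding matrix_rep_def bullet_cong_def elem_cong_iff
    using cong by (auto simp: \<phi>_def rcong_def)
  ultimately show "\<exists>\<phi> \<in> hom (elem_group G) (bullet_group G). matrix_rep G M \<phi>" by blast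
qed

end

section \<open>Continuity on \<open>G\<close> through local sections of the cover\<close>

lemma topspace_factor_topology: "topspace (factor_topology F) = factor_carrier F"
  by (cases F) (auto simp: topspace_pullback_topology)

lemma continuous_map_group_topology_component:
  "continuous_map (group_topology G) (factor_topology (G i)) (\<lambda>x. x $ i)"
  using continuous_map_pullback[OF continuous_map_product_coordinates[OF UNIV_I]]
  unfolding group_topology_def comp_def by metis

lemma continuous_map_into_group_topology:
  assumes "\<And>i. continuous_map X (factor_topology (G i)) (\<lambda>x. f x $ i)"
  shows "continuous_map X (group_topology G) f"
  unfolding group_topology_def
  by (rule continuous_map_pullback')
    (use assms in \<open>auto simp: comp_def continuous_map_componentwise_UNIV\<close>)

lemma continuous_map_factor_topology_id:
  "F \<noteq> Circle \<Longrightarrow> continuous_map (factor_topology F) euclidean (\<lambda>x. x)"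
  by (cases F) (auto intro: continuous_map_from_subtopology)

lemma continuous_map_circle_cis:
  "continuous_map (factor_topology Circle) euclidean (\<lambda>x. cis (2 * pi * x))"
proof -
  have "continuous_map (pullback_topology {0..<1} (\<lambda>x. cis (2 * pi * x)) euclidean) euclidean
      ((\<lambda>z. z) \<circ> (\<lambda>x. cis (2 * pi * x)))"
    by (rule continuous_map_pullback) simp
  then show ?thesis by (simp add: comp_def)
qed

text \<open>A path through the base point of a circle jumps between 0 and values near 1 as a real
  number. Shifting by periods removes the jump near \<open>a\<close>, so the lift converges in the
  Euclidean topology.\<close>

lemma local_lift:
  assumes p: "continuous_map X (group_topology G) p" and a: "a \<in> topspace X"
  obtains s where "(s \<longlongrightarrow> p a) (atin X a)" "\<And>t. s t - p t \<in> period G"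
proof -
  \<comment> \<open>Circle coordinates start from \<open>p a\<close> and add the principal argument
    of the quotient, which is continuous near 1; the other coordinates already converge.\<close>
  define s where "s t = (\<chi> i. if G i = Circle
      then p a $ i + Arg (cis (2 * pi * p t $ i) / cis (2 * pi * p a $ i)) / (2 * pi)
      else p t $ i)" for t
  have comp: "continuous_map X (factor_topology (G i)) (\<lambda>t. p t $ i)" for i
    using continuous_map_compose[OF p continuous_map_group_topology_component, of i]
    by (simp add: comp_def)
  have "((\<lambda>t. s t $ i) \<longlongrightarrow> p a $ i) (atin X a)" for i
  proof (cases "G i = Circle")
    case True
    have "continuous_map X euclidean (\<lambda>t. cis (2 * pi * p t $ i))"
      using continuous_map_compose[OF comp[of i, unfolded True] continuous_map_circle_cis]
      by (simp only: comp_def)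
    then have "((\<lambda>t. cis (2 * pi * p t $ i)) \<longlongrightarrow> cis (2 * pi * p a $ i)) (atin X a)"
      using a unfolding continuous_map_atin by simp
    then have "((\<lambda>t. cis (2 * pi * p t $ i) / cis (2 * pi * p a $ i)) \<longlongrightarrow> 1) (atin X a)"
      by (rule tendsto_divide[OF _ tendsto_const, THEN tendsto_eq_rhs]) auto
    then have "((\<lambda>t. Arg (cis (2 * pi * p t $ i) / cis (2 * pi * p a $ i))) \<longlongrightarrow> Arg 1) (atin X a)"
      by (rule tendsto_Arg) auto
    then have "((\<lambda>t. p a $ i + Arg (cis (2 * pi * p t $ i) / cis (2 * pi * p a $ i)) / (2 * pi))
        \<longlongrightarrow> p a $ i + Arg 1 / (2 * pi)) (atin X a)"
      by (intro tendsto_add tendsto_divide tendsto_const) auto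
    then show ?thesis using True by (simp add: s_def)
  next
    case False
    then have "continuous_map X euclidean (\<lambda>t. p t $ i)"
      using continuous_map_compose[OF comp[of i] continuous_map_factor_topology_id[OF False]]
      by (simp only: comp_def)
    then show ?thesis using a False unfolding continuous_map_atin by (simp add: s_def)
  qed
  then have "(s \<longlongrightarrow> p a) (atin X a)" by (rule vec_tendstoI)
  moreover have "s t - p t \<in> period G" for t
    unfolding period_def
  proof safe
    fix i
    show "\<exists>n::int. (s t - p t) $ i = of_int n * factor_char (G i)"
    proof (cases "G i = Circle")
      case True
      \<comment> \<open>Both \<open>Arg z / (2 * pi)\<close> and \<open>d\<close> are logarithms of
        \<open>z\<close>, so they differ by an integer, which is a period of the circle.\<close>
      define d where "d = p t $ i - p a $ i"
      define z where "z = cis (2 * pi * p t $ i) / cis (2 * pi * p a $ i)"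
      have z: "z = unit_exp d"
        by (simp add: z_def d_def unit_exp_def cis_divide right_diff_distrib)
      have "unit_exp (Arg z / (2 * pi)) = unit_exp d"
        unfolding unit_exp_def[of "Arg z / (2 * pi)"] using cis_Arg[of z] z
        by (simp add: sgn_div_norm)
      then have "Arg z / (2 * pi) - d \<in> \<int>" by (simp only: unit_exp_eq_iff)
      then obtain n where "Arg z / (2 * pi) - d = of_int n" by (elim Ints_cases)
      then show ?thesis
        using True by (intro exI[of _ n]) (simp add: s_def z_def[symmetric], simp add: d_def)
    qed (auto simp: s_def intro: exI[of _ 0])
  qed
  ultimately show thesis by (rule that)
qed

text \<open>Near each point replace \<open>p\<close> and \<open>q\<close> by convergent lifts:
  continuity of \<open>F\<close> gives the limit, and periodicity shows that the values are
  unchanged.\<close>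

lemma continuous_map_periodic:
  fixes F :: "real ^ 'm::finite \<Rightarrow> real ^ 'm \<Rightarrow> 'b::topological_space"
  assumes p: "continuous_map X (group_topology G) p" and q: "continuous_map X (group_topology G) q"
    and F: "continuous_on UNIV (\<lambda>z. F (fst z) (snd z))"
    and per: "\<And>x y k l. x \<in> cover G \<Longrightarrow> y \<in> cover G \<Longrightarrow> k \<in> period G \<Longrightarrow> l \<in> period G \<Longrightarrow>
      F (x + k) (y + l) = F x y"
  shows "continuous_map X euclidean (\<lambda>t. F (p t) (q t))"
  unfolding continuous_map_atin limitin_canonical_iff
proof
  fix a assume a: "a \<in> topspace X"
  obtain s where s: "(s \<longlongrightarrow> p a) (atin X a)" "\<And>t. s t - p t \<in> period G"
    using local_lift[OF p a] by blast
  obtain r where r: "(r \<longlongrightarrow> q a) (atin X a)" "\<And>t. r t - q t \<in> period G"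
    using local_lift[OF q a] by blast
  have "isCont (\<lambda>z. F (fst z) (snd z)) (p a, q a)"
    using F by (simp add: continuous_on_eq_continuous_at)
  from isCont_tendsto_compose[OF this tendsto_Pair[OF s(1) r(1)]]
  have lim: "((\<lambda>t. F (s t) (r t)) \<longlongrightarrow> F (p a) (q a)) (atin X a)" by simp
  have eq: "F (s t) (r t) = F (p t) (q t)" if "t \<in> topspace X" for t
  proof -
    have "p t \<in> cover G" "q t \<in> cover G"
      using that p q carrier_subset_cover
      by (force simp: continuous_map_def topspace_group_topology Pi_iff)+
    then show ?thesis using per[of "p t" "q t", OF _ _ s(2)[of t] r(2)[of t]] by simp
  qed
  show "((\<lambda>t. F (p t) (q t)) \<longlongrightarrow> F (p a) (q a)) (atin X a)"
  proof (rule Lim_transform_eventually[OF lim])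
    show "\<forall>\<^sub>F t in atin X a. F (s t) (r t) = F (p t) (q t)"
      unfolding eventually_atin using eq a by (intro disjI2 exI[of _ "topspace X"]) auto
  qed
qed

text \<open>This pulls continuity on \<open>G\<close> back to the line. On a circle,
  \<open>x rmod 1\<close> jumps at integers as a real number, but the topology sees only its image
  under \<open>cis\<close>, which does not jump.\<close>

lemma (in valid_factors) continuous_map_reduce_axis:
  assumes "factor_cover (G i) = UNIV"
  shows "continuous_map euclidean (group_topology G) (\<lambda>x. reduce G (axis i x))"
proof (rule continuous_map_into_group_topology)
  fix j
  show "continuous_map euclidean (factor_topology (G j)) (\<lambda>x. reduce G (axis i x) $ j)"
  proof (cases "j = i")
    case True
    have "(\<int> :: real set) \<noteq> UNIV" using all_multiples_Ints_imp_zero[of 1] by auto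
    then consider "G i = Reals" | "G i = Circle" using assms by (cases "G i") auto
    then show ?thesis
    proof cases
      case 1
      then show ?thesis using True by (simp add: reduce_def)
    next
      case 2
      have "continuous_map euclidean (factor_topology Circle) (\<lambda>x. x rmod 1)"
        unfolding factor_topology.simps
      proof (rule continuous_map_pullback')
        have "cis (2 * pi * (x rmod 1)) = cis (2 * pi * x)" for x
          using unit_exp_eq_iff[of "x rmod 1" x]
          by (simp add: unit_exp_def rmod_def)
        then show "continuous_map euclidean euclidean ((\<lambda>x. cis (2 * pi * x)) \<circ> (\<lambda>x. x rmod 1))"
          by (auto simp: comp_def intro!: continuous_intros)
      qed (auto simp: rmod_nonneg rmod_less)
      then show ?thesis using True 2 by (simp add: reduce_def)
    qed
  next
    case False
    have "0 \<in> factor_carrier (G j)" using rmod_in_factor_carrier[of 0 j] by simp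
    then show ?thesis using False by (simp add: reduce_def axis_def topspace_factor_topology)
  qed
qed

section \<open>Gaussians of symmetric matrices and their invariance under periods\<close>

definition gaussian :: "real ^ 'm ^ 'm \<Rightarrow> real ^ 'm \<Rightarrow> real ^ 'm::finite \<Rightarrow> complex" where
  "gaussian M C x = unit_exp ((x \<bullet> (M *v x) + C \<bullet> x) / 2)"

text \<open>Polarisation: symmetry makes the two cross terms equal, and their sum cancels the factor
  one half.\<close>

lemma gaussian_add:
  assumes "transpose M = M"
  shows "gaussian M C (x + y) = gaussian M C x * gaussian M C y * unit_exp (x \<bullet> (M *v y))"
  unfolding gaussian_def unit_exp_add[symmetric] using inner_symmetric_matrix[OF assms, of y x]
  by (intro arg_cong[where f = unit_exp])
    (simp add: matrix_vector_right_distrib inner_add_left inner_add_right field_simps)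

lemma norm_gaussian [simp]: "norm (gaussian M C x) = 1"
  by (simp add: gaussian_def)

lemma continuous_on_matrix_vector_mult [continuous_intros]:
  "continuous_on S f \<Longrightarrow> continuous_on S (\<lambda>x. (M :: real ^ 'n ^ 'm) *v f x)"
  by (intro continuous_on_compose2[OF linear_continuous_on, of "(*v) M"]) auto

lemma exp_eq_unit_exp: "exp (complex_of_real pi * \<i> * complex_of_real t) = unit_exp (t / 2)"
  by (simp add: unit_exp_def cis_conv_exp mult_ac)

lemma integral_on_period_axis:
  assumes "integral_on_period G M" "l \<in> factor_cover (G j)"
  shows "factor_char (G i) * M $ i $ j * l \<in> \<int>"
proof -
  have "axis i (factor_char (G i)) \<bullet> (M *v axis j l) \<in> \<int>"
    using assms cover_axis[of l G j] period_axis[of i 1 G]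
    unfolding integral_on_period_def by simp
  moreover have "(M *v axis j l) $ i = M $ i $ j * l"
    by (simp add: matrix_vector_mult_def axis_def if_distrib cong: if_cong)
  ultimately show ?thesis by (simp only: inner_axis_left mult.assoc)
qed

context valid_factors
begin

context
  fixes M :: "real ^ 'm ^ 'm" and C :: "real ^ 'm"
  assumes sym: "transpose M = M"
    and int: "integral_on_period G M"
    and C: "\<And>i. C $ i = M $ i $ i * factor_char (G i)"
begin

lemma C_Ints: "C $ i \<in> \<int>"
  using integral_on_period_axis[OF int, of 1 i i] by (simp add: C mult.commute)

lemma unit_exp_period:
  assumes "k \<in> period G" "x \<in> cover G"
  shows "unit_exp (k \<bullet> (M *v x)) = 1" "unit_exp (x \<bullet> (M *v k)) = 1"
  using assms int inner_symmetric_matrix[OF sym, of x k]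
  by (auto simp: unit_exp_eq_1_iff integral_on_period_def)

text \<open>On a single coordinate period \<open>n c\<close> the exponent is \<open>c (c M\<^sub>i\<^sub>i) n (n + 1) / 2\<close>.
  The linear term \<open>C\<close> is there to turn \<open>n\<^sup>2\<close> into the even number \<open>n (n + 1)\<close>.\<close>

lemma gaussian_period_axis: "gaussian M C (axis i (of_int n * factor_char (G i))) = 1"
proof -
  define c where "c = factor_char (G i)"
  obtain m :: int where m: "of_int (n * (n + 1)) = 2 * (of_int m :: real)"
  proof -
    have "even (n * (n + 1))" by simp
    then obtain m where "n * (n + 1) = 2 * m" by (elim evenE)
    then have "of_int (n * (n + 1)) = (of_int (2 * m) :: real)" by (rule arg_cong)
    then show thesis by (intro that[of m]) simp
  qed
  have "(M *v axis i (of_int n * c)) $ i = M $ i $ i * (of_int n * c)"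
    by (simp add: matrix_vector_mult_def axis_def if_distrib cong: if_cong)
  then have "axis i (of_int n * c) \<bullet> (M *v axis i (of_int n * c)) + C \<bullet> axis i (of_int n * c) =
      c * (M $ i $ i * c) * of_int (n * (n + 1))"
    by (simp add: inner_axis_left inner_axis C c_def algebra_simps)
  also have "\<dots> / 2 = c * (M $ i $ i * c) * of_int m" unfolding m by simp
  also have "\<dots> \<in> \<int>"
    unfolding c_def using C_Ints[of i, unfolded C]
    by (rule Ints_mult[OF Ints_mult[OF factor_char_Ints] Ints_of_int])
  finally show ?thesis unfolding gaussian_def c_def unit_exp_eq_1_iff .
qed

text \<open>Between periods the cross term in \<open>gaussian_add\<close> is trivial, so the
  Gaussian is multiplicative on the group of periods and it suffices to check each axis.\<close>

lemma gaussian_period: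
  assumes k: "k \<in> period G"
  shows "gaussian M C k = 1"
proof -
  have *: "(\<forall>i. x $ i \<in> {y. \<exists>n::int. y = of_int n * factor_char (G i)}) \<longleftrightarrow> x \<in> period G" for x
    by (simp add: period_def)
  have "gaussian M C k = (\<Prod>i\<in>UNIV. gaussian M C (axis i (k $ i)))"
  proof (rule multiplicative_prod_axis[where A = "\<lambda>i. {y. \<exists>n::int. y = of_int n * factor_char (G i)}"])
    show "gaussian M C (x + y) = gaussian M C x * gaussian M C y"
      if "\<forall>i. x $ i \<in> {y. \<exists>n::int. y = of_int n * factor_char (G i)}"
        "\<forall>i. y $ i \<in> {y. \<exists>n::int. y = of_int n * factor_char (G i)}" for x y
      using that unfolding * gaussian_add[OF sym]
      by (simp add: unit_exp_period period_subset_cover)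
    show "0 \<in> {y. \<exists>n::int. y = of_int n * factor_char (G i)}" for i by (auto intro: exI[of _ 0])
    show "gaussian M C 0 = 1" by (simp add: gaussian_def)
    show "k $ i \<in> {y. \<exists>n::int. y = of_int n * factor_char (G i)}" for i
      using k by (simp add: period_def)
  qed
  also have "\<dots> = 1"
  proof (rule prod.neutral, safe)
    fix i
    obtain n :: int where "k $ i = of_int n * factor_char (G i)"
      using k unfolding period_def by blast
    then show "gaussian M C (axis i (k $ i)) = 1" by (simp only: gaussian_period_axis)
  qed
  finally show ?thesis .
qed

lemma gaussian_periodic:
  assumes "x \<in> cover G" "k \<in> period G"
  shows "gaussian M C (x + k) = gaussian M C x"
  using assms by (simp add: gaussian_add[OF sym] gaussian_period unit_exp_period)

lemma unit_exp_matrix_periodic: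
  assumes "x \<in> cover G" "y \<in> cover G" "k \<in> period G" "l \<in> period G"
  shows "unit_exp ((x + k) \<bullet> (M *v (y + l))) = unit_exp (x \<bullet> (M *v y))"
  using assms
  by (simp add: matrix_vector_right_distrib inner_add_left inner_add_right unit_exp_add
      unit_exp_period period_subset_cover)

text \<open>Arbitrary maps \<open>p\<close> and \<open>q\<close> let one statement serve joint
  continuity, with the projections, and separate continuity, with one map constant.\<close>

lemma continuous_map_unit_exp_matrix:
  assumes "continuous_map X (group_topology G) p" "continuous_map X (group_topology G) q"
  shows "continuous_map X (top_of_set (carrier U1)) (\<lambda>t. unit_exp (p t \<bullet> (M *v q t)))"
  unfolding continuous_map_in_subtopology
proof
  show "continuous_map X euclidean (\<lambda>t. unit_exp (p t \<bullet> (M *v q t)))"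
    using assms
    by (rule continuous_map_periodic) (auto intro!: continuous_intros unit_exp_matrix_periodic)
qed (auto simp: U1_def)

lemma bicharacter_unit_exp_matrix: "bicharacter G (\<lambda>g h. unit_exp (g \<bullet> (M *v h)))"
  unfolding bicharacter_def is_character_def
proof (intro conjI ballI)
  have const: "continuous_map (group_topology G) (group_topology G) (\<lambda>g. h)"
    if "h \<in> carrier (elem_group G)" for h
    using that by (simp add: topspace_group_topology)
  show "continuous_map (prod_topology (group_topology G) (group_topology G))
      (top_of_set (carrier U1)) (\<lambda>(g, h). unit_exp (g \<bullet> (M *v h)))"
    unfolding case_prod_unfold
    by (intro continuous_map_unit_exp_matrix continuous_map_fst continuous_map_snd)
  fix h assume h: "h \<in> carrier (elem_group G)"
  show "continuous_map (group_topology G) (top_of_set (carrier U1)) (\<lambda>g. unit_exp (g \<bullet> (M *v h)))"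
    "continuous_map (group_topology G) (top_of_set (carrier U1)) (\<lambda>g. unit_exp (h \<bullet> (M *v g)))"
    by (intro continuous_map_unit_exp_matrix const h continuous_map_id[unfolded id_def])+
  have add: "unit_exp (reduce G (g + g') \<bullet> (M *v h)) = unit_exp (g \<bullet> (M *v h)) * unit_exp (g' \<bullet> (M *v h))"
    if "g \<in> carrier (elem_group G)" "g' \<in> carrier (elem_group G)" for g g'
  proof -
    have "g + g' \<in> cover G" using that by (intro cover_add carrier_subset_cover)
    then have "unit_exp (reduce G (g + g') \<bullet> (M *v h)) = unit_exp ((g + g') \<bullet> (M *v h))"
      using unit_exp_matrix_periodic[of "g + g'" h "reduce G (g + g') - (g + g')" 0]
        carrier_subset_cover[OF h] by (simp add: reduce_diff_period)
    then show ?thesis by (simp add: inner_add_left unit_exp_add)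
  qed
  show "(\<lambda>g. unit_exp (g \<bullet> (M *v h))) \<in> hom (elem_group G) U1"
    using add by (auto simp: hom_def U1_def elem_group_mult)
  show "(\<lambda>g. unit_exp (h \<bullet> (M *v g))) \<in> hom (elem_group G) U1"
    using add unfolding inner_symmetric_matrix[OF sym, of h]
    by (auto simp: hom_def U1_def elem_group_mult)
qed

lemma quadratic_gaussian:
  assumes v: "v \<in> carrier (bullet_group G)"
    and \<xi>: "\<And>g. g \<in> carrier (elem_group G) \<Longrightarrow> \<xi> g = gaussian M C g * unit_exp (v \<bullet> g)"
  shows "quadratic G \<xi>"
  unfolding quadratic_def
proof (intro conjI exI ballI)
  \<comment> \<open>The formula makes sense on the whole space and is periodic on the cover, so
    \<open>\<xi>\<close> at a product in \<open>G\<close> can be computed at the unreduced sum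
    \<open>g + h\<close>.\<close>
  define \<eta> where "\<eta> x = gaussian M C x * unit_exp (v \<bullet> x)" for x
  have "factor_char (G i) * v $ i \<in> \<int>" for i
    using v by (intro bullet_carrier_char) (auto simp: bullet_group_def residue_product_def)
  then have "k \<bullet> v \<in> \<int>" if "k \<in> period G" for k
    using that by (intro period_inner_Ints)
  then have \<eta>_periodic: "\<eta> (x + k) = \<eta> x" if "x \<in> cover G" "k \<in> period G" for x k
    using that unit_exp_eq_1_iff[of "v \<bullet> k"]
    by (simp add: \<eta>_def gaussian_periodic inner_add_right unit_exp_add inner_commute[of v])
  have \<xi>_eq: "\<xi> g = \<eta> g" if "g \<in> carrier (elem_group G)" for g
    using \<xi>[OF that] by (simp add: \<eta>_def)
  have "continuous_on UNIV (\<lambda>z. \<eta> (fst z))"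
    unfolding \<eta>_def gaussian_def by (intro continuous_intros) auto
  \<comment> \<open>The two-variable continuity lemma is applied with a dummy second
    variable.\<close>
  then have "continuous_map (group_topology G) euclidean \<eta>"
    using continuous_map_periodic[of "group_topology G" G "\<lambda>g. g" "\<lambda>g. g" "\<lambda>x y. \<eta> x"] \<eta>_periodic
    by simp
  then have "continuous_map (group_topology G) euclidean \<xi>"
    by (rule continuous_map_eq) (simp add: \<xi>_eq topspace_group_topology)
  then show "continuous_map (group_topology G) (top_of_set (carrier U1)) \<xi>"
    by (auto simp: continuous_map_in_subtopology topspace_group_topology \<xi> U1_def norm_mult)
  show "bicharacter G (\<lambda>g h. unit_exp (g \<bullet> (M *v h)))" by (rule bicharacter_unit_exp_matrix)
  fix g h assume g: "g \<in> carrier (elem_group G)" and h: "h \<in> carrier (elem_group G)"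
  have gh: "g + h \<in> cover G" using g h by (intro cover_add carrier_subset_cover)
  have "\<xi> (g \<otimes>\<^bsub>elem_group G\<^esub> h) = \<eta> (reduce G (g + h))"
    using reduce_in_carrier[OF gh] by (simp add: elem_group_mult \<xi>_eq)
  also have "\<dots> = \<eta> (g + h)"
    using \<eta>_periodic[OF gh reduce_diff_period[of G "g + h"]] by simp
  also have "\<dots> = \<xi> g * \<xi> h * unit_exp (g \<bullet> (M *v h))"
    by (simp add: \<xi>_eq g h) (simp add: \<eta>_def gaussian_add[OF sym] inner_add_right unit_exp_add)
  finally show "\<xi> (g \<otimes>\<^bsub>elem_group G\<^esub> h) = \<xi> g * \<xi> h * unit_exp (g \<bullet> (M *v h))" .
qed

end

end

section \<open>Characters and symmetric bicharacters of the cover\<close>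

lemma additive_Ints_imp_zero:
  fixes k :: "real \<Rightarrow> real"
  assumes add: "\<And>x y. k (x + y) = k x + k y" and int: "\<And>x. k x \<in> \<int>"
  shows "k x = 0"
proof -
  have half: "k x = 2 * k (x / 2)" for x using add[of "x / 2" "x / 2"] by simp
  \<comment> \<open>Without continuity, divisibility does the work: repeated halving of the argument
    shows that the integer \<open>k x\<close> is divisible by every power of two, hence 0.\<close>
  have div: "k x / 2 ^ n \<in> \<int>" for n x
  proof (induction n arbitrary: x)
    case (Suc n)
    have "k x / 2 ^ Suc n = k (x / 2) / 2 ^ n" by (subst half) simp
    then show ?case using Suc by simp
  qed (simp add: int)
  obtain n where "\<bar>k x\<bar> < 2 ^ n" using real_arch_pow[of 2 "\<bar>k x\<bar>"] by auto
  then have "\<bar>k x / 2 ^ n\<bar> < 1" by simp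
  then have "k x / 2 ^ n = 0" using Ints_nonzero_abs_less1 div by blast
  then show ?thesis by simp
qed

lemma factor_character:
  fixes f :: "real \<Rightarrow> complex"
  assumes add: "\<And>x y. x \<in> factor_cover F \<Longrightarrow> y \<in> factor_cover F \<Longrightarrow> f (x + y) = f x * f y"
    and norm: "\<And>x. x \<in> factor_cover F \<Longrightarrow> norm (f x) = 1"
    and cont: "factor_cover F = UNIV \<Longrightarrow> continuous_on UNIV f"
  shows "\<exists>v. \<forall>x\<in>factor_cover F. f x = unit_exp (v * x)"
proof (cases rule: factor_cover_cases[of F])
  case 1
  obtain v where "f 1 = unit_exp v" using norm_one_eq_unit_exp[OF norm[of 1]] by auto
  then have "f x = unit_exp (v * x)" if "x \<in> \<int>" for x
    using add 1 that by (intro multiplicative_on_Ints) auto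
  with 1 show ?thesis by auto
next
  case 2
  then show ?thesis using real_character[of f] assms by auto metis
qed

text \<open>The character \<open>b 1\<close> of the second factor has a frequency, and
  multiplicativity in the integer argument propagates it from 1 to all of \<int>.\<close>

lemma factor_bicharacter_Ints:
  fixes b :: "real \<Rightarrow> real \<Rightarrow> complex"
  assumes F: "factor_cover F = \<int>"
    and add1: "\<And>x x' y. x \<in> factor_cover F \<Longrightarrow> x' \<in> factor_cover F \<Longrightarrow> y \<in> factor_cover F' \<Longrightarrow>
      b (x + x') y = b x y * b x' y"
    and add2: "\<And>x y y'. x \<in> factor_cover F \<Longrightarrow> y \<in> factor_cover F' \<Longrightarrow> y' \<in> factor_cover F' \<Longrightarrow>
      b x (y + y') = b x y * b x y'"
    and norm: "\<And>x y. x \<in> factor_cover F \<Longrightarrow> y \<in> factor_cover F' \<Longrightarrow> norm (b x y) = 1"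
    and cont2: "\<And>x. x \<in> factor_cover F \<Longrightarrow> factor_cover F' = UNIV \<Longrightarrow> continuous_on UNIV (b x)"
  shows "\<exists>\<mu>. \<forall>x\<in>factor_cover F. \<forall>y\<in>factor_cover F'. b x y = unit_exp (\<mu> * x * y)"
proof -
  obtain w where w: "\<forall>y\<in>factor_cover F'. b 1 y = unit_exp (w * y)"
    using factor_character[of F' "b 1"] add2 norm cont2 by auto
  have "b x y = unit_exp (w * y * x)" if "x \<in> factor_cover F" "y \<in> factor_cover F'" for x y
    using that w add1 F by (intro multiplicative_on_Ints[of "\<lambda>x. b x y"]) auto
  then show ?thesis by (intro exI[of _ w]) (simp add: mult_ac)
qed

text \<open>Over two copies of the real line, \<open>b x y = unit_exp (w x * y) = unit_exp (v y * x)\<close>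
  with \<open>w\<close> additive. Setting \<open>y = 1\<close> shows that \<open>v 1 * x - w x\<close> is an additive function of \<open>x\<close>
  with integer values, so it vanishes.\<close>

lemma factor_bicharacter:
  fixes b :: "real \<Rightarrow> real \<Rightarrow> complex"
  assumes add1: "\<And>x x' y. x \<in> factor_cover F \<Longrightarrow> x' \<in> factor_cover F \<Longrightarrow> y \<in> factor_cover F' \<Longrightarrow>
      b (x + x') y = b x y * b x' y"
    and add2: "\<And>x y y'. x \<in> factor_cover F \<Longrightarrow> y \<in> factor_cover F' \<Longrightarrow> y' \<in> factor_cover F' \<Longrightarrow>
      b x (y + y') = b x y * b x y'"
    and norm: "\<And>x y. x \<in> factor_cover F \<Longrightarrow> y \<in> factor_cover F' \<Longrightarrow> norm (b x y) = 1"
    and cont1: "\<And>y. y \<in> factor_cover F' \<Longrightarrow> factor_cover F = UNIV \<Longrightarrow>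
      continuous_on UNIV (\<lambda>x. b x y)"
    and cont2: "\<And>x. x \<in> factor_cover F \<Longrightarrow> factor_cover F' = UNIV \<Longrightarrow> continuous_on UNIV (b x)"
  shows "\<exists>\<mu>. \<forall>x\<in>factor_cover F. \<forall>y\<in>factor_cover F'. b x y = unit_exp (\<mu> * x * y)"
proof (cases "factor_cover F = \<int> \<or> factor_cover F' = \<int>")
  case True
  then show ?thesis
  proof
    assume "factor_cover F = \<int>"
    then show ?thesis using add1 add2 norm cont2 by (rule factor_bicharacter_Ints)
  next
    assume "factor_cover F' = \<int>"
    then have "\<exists>\<mu>. \<forall>y\<in>factor_cover F'. \<forall>x\<in>factor_cover F. b x y = unit_exp (\<mu> * y * x)"
      using add1 add2 norm cont1 by (intro factor_bicharacter_Ints) auto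
    then show ?thesis by (metis mult.commute mult.left_commute)
  qed
next
  case False
  then have F: "factor_cover F = UNIV" "factor_cover F' = UNIV"
    by (metis factor_cover_cases)+
  have "\<exists>v. \<forall>x\<in>factor_cover F. b x y = unit_exp (v * x)" for y
    using add1 norm cont1 F by (intro factor_character) auto
  then obtain v where v: "\<And>x y. b x y = unit_exp (v y * x)" using F by simp metis
  have "\<exists>w. \<forall>y\<in>factor_cover F'. b x y = unit_exp (w * y)" for x
    using add2 norm cont2 F by (intro factor_character) auto
  then obtain w where w: "\<And>x y. b x y = unit_exp (w x * y)" using F by simp metis
  have w_add: "w (x + x') = w x + w x'" for x x'
  proof -
    have "(w (x + x') - (w x + w x')) * y \<in> \<int>" for y
    proof -
      have "unit_exp (w (x + x') * y) = unit_exp (w x * y + w x' * y)"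
        unfolding unit_exp_add w[symmetric] using add1 F by simp
      then show ?thesis by (simp add: unit_exp_eq_iff algebra_simps)
    qed
    then have "w (x + x') - (w x + w x') = 0" by (rule all_multiples_Ints_imp_zero)
    then show ?thesis by simp
  qed
  have "v 1 * x - w x = 0" for x
  proof (rule additive_Ints_imp_zero[of "\<lambda>x. v 1 * x - w x"])
    show "v 1 * x - w x \<in> \<int>" for x
      using v[of x 1] w[of x 1] by (simp flip: unit_exp_eq_iff)
  qed (simp add: w_add algebra_simps)
  then have "b x y = unit_exp (v 1 * x * y)" for x y
    using w[of x y] by simp
  then show ?thesis by blast
qed

context valid_factors
begin

lemma cover_character:
  assumes add: "\<And>x y. x \<in> cover G \<Longrightarrow> y \<in> cover G \<Longrightarrow> f (x + y) = f x * f y"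
    and norm: "\<And>x. x \<in> cover G \<Longrightarrow> norm (f x) = 1"
    and cont: "\<And>i. factor_cover (G i) = UNIV \<Longrightarrow> continuous_on UNIV (\<lambda>x. f (axis i x))"
  obtains v where "\<And>x. x \<in> cover G \<Longrightarrow> f x = unit_exp (v \<bullet> x)"
proof -
  have "\<exists>v. \<forall>x\<in>factor_cover (G i). f (axis i x) = unit_exp (v * x)" for i
    using cont by (intro factor_character) (simp_all add: axis_add cover_axis add norm)
  then obtain v where v: "\<And>i x. x \<in> factor_cover (G i) \<Longrightarrow> f (axis i x) = unit_exp (v i * x)"
    by metis
  have "f 0 * f 0 = f 0 * 1" using add[of 0 0] by simp
  then have f0: "f 0 = 1" using norm[of 0] by (subst (asm) mult_cancel_left) auto
  have "f x = unit_exp ((\<chi> i. v i) \<bullet> x)" if x: "x \<in> cover G" for x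
  proof -
    have "f x = (\<Prod>i\<in>UNIV. f (axis i (x $ i)))"
      using x add f0
      by (intro multiplicative_prod_axis[where A = "\<lambda>i. factor_cover (G i)"]) (auto simp: cover_def)
    also have "\<dots> = (\<Prod>i\<in>UNIV. unit_exp (v i * x $ i))"
      using x v by (intro prod.cong) (auto simp: cover_def)
    finally show ?thesis by (simp add: inner_vec_def unit_exp_sum)
  qed
  then show thesis by (rule that)
qed

text \<open>Expanding both arguments along the axes reduces the claim to pairs of factors, whose
  coefficients become the entries of \<open>M\<close>.\<close>

lemma cover_bicharacter:
  assumes add1: "\<And>x x' y. x \<in> cover G \<Longrightarrow> x' \<in> cover G \<Longrightarrow> y \<in> cover G \<Longrightarrow>
      b (x + x') y = b x y * b x' y"
    and sym: "\<And>x y. x \<in> cover G \<Longrightarrow> y \<in> cover G \<Longrightarrow> b x y = b y x"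
    and norm: "\<And>x y. x \<in> cover G \<Longrightarrow> y \<in> cover G \<Longrightarrow> norm (b x y) = 1"
    and cont: "\<And>i y. y \<in> cover G \<Longrightarrow> factor_cover (G i) = UNIV \<Longrightarrow>
      continuous_on UNIV (\<lambda>x. b (axis i x) y)"
  obtains M :: "real ^ 'm ^ 'm" where "transpose M = M"
    "\<And>x y. x \<in> cover G \<Longrightarrow> y \<in> cover G \<Longrightarrow> b x y = unit_exp (x \<bullet> (M *v y))"
proof -
  have add2: "b x (y + y') = b x y * b x y'" if "x \<in> cover G" "y \<in> cover G" "y' \<in> cover G" for x y y'
    using that add1 sym cover_add by metis
  have cont2: "continuous_on UNIV (\<lambda>y. b x (axis j y))"
    if "x \<in> cover G" "factor_cover (G j) = UNIV" for x j
    using cont[OF that] sym[OF that(1)] cover_axis[of _ G j] that(2) by simp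
  \<comment> \<open>A coefficient need not be unique: between two integer factors it is determined
    only modulo 1. Choosing from the full set of admissible values yields a symmetric
    \<open>M\<close>, because \<open>S i j\<close> and \<open>S j i\<close> are equal sets and the
    choice depends only on the set.\<close>
  define S where "S i j = {\<mu>. \<forall>x\<in>factor_cover (G i). \<forall>y\<in>factor_cover (G j).
    b (axis i x) (axis j y) = unit_exp (\<mu> * x * y)}" for i j
  have "\<exists>\<mu>. \<mu> \<in> S i j" for i j
    unfolding S_def mem_Collect_eq
    by (intro factor_bicharacter) (simp_all add: axis_add cover_axis add1 add2 norm cont cont2)
  then have S: "(SOME \<mu>. \<mu> \<in> S i j) \<in> S i j" for i j by (rule someI_ex)
  have S_sym: "S i j = S j i" for i j
    unfolding S_def using sym[OF cover_axis cover_axis] by (auto simp: mult_ac)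
  define M :: "real ^ 'm ^ 'm" where "M = (\<chi> i j. SOME \<mu>. \<mu> \<in> S i j)"
  have M: "b (axis i x) (axis j y) = unit_exp (M $ i $ j * x * y)"
    if "x \<in> factor_cover (G i)" "y \<in> factor_cover (G j)" for i j x y
    using S[of i j] that by (simp add: S_def[of i j] M_def)
  have zero: "b 0 y = 1" "b y 0 = 1" if "y \<in> cover G" for y
  proof -
    have "b 0 y * b 0 y = b 0 y * 1" using add1[of 0 0 y] that by simp
    then show "b 0 y = 1" using norm[of 0 y] that by (subst (asm) mult_cancel_left) auto
    then show "b y 0 = 1" using sym that by simp
  qed
  have "b x y = unit_exp (x \<bullet> (M *v y))" if x: "x \<in> cover G" and y: "y \<in> cover G" for x y
  proof -
    have xi: "axis i (x $ i) \<in> cover G" for i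
      using x by (intro cover_axis) (auto simp: cover_def)
    have "b x y = (\<Prod>i\<in>UNIV. b (axis i (x $ i)) y)"
      using x y add1 zero
      by (intro multiplicative_prod_axis[where A = "\<lambda>i. factor_cover (G i)"]) (auto simp: cover_def)
    also have "\<dots> = (\<Prod>i\<in>UNIV. \<Prod>j\<in>UNIV. b (axis i (x $ i)) (axis j (y $ j)))"
    proof (rule prod.cong[OF refl])
      fix i
      show "b (axis i (x $ i)) y = (\<Prod>j\<in>UNIV. b (axis i (x $ i)) (axis j (y $ j)))"
        using y zero(2)[OF xi[of i]] add2[OF xi[of i]]
        by (intro multiplicative_prod_axis[where A = "\<lambda>i. factor_cover (G i)"]) (auto simp: cover_def)
    qed
    also have "\<dots> = (\<Prod>i\<in>UNIV. \<Prod>j\<in>UNIV. unit_exp (M $ i $ j * x $ i * y $ j))"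
      using x y by (intro prod.cong refl M) (auto simp: cover_def)
    also have "\<dots> = unit_exp (x \<bullet> (M *v y))"
      by (simp add: unit_exp_sum[symmetric] inner_vec_def matrix_vector_mult_def sum_distrib_left mult_ac)
    finally show ?thesis .
  qed
  moreover have "transpose M = M"
    by (simp add: transpose_def M_def vec_eq_iff S_sym)
  ultimately show thesis by (intro that)
qed

section \<open>From a quadratic function to its Gaussian and frequency\<close>

lemma continuous_on_character_axis:
  assumes "continuous_map (group_topology G) (top_of_set (carrier U1)) f"
    and "factor_cover (G i) = UNIV"
  shows "continuous_on UNIV (\<lambda>x. f (reduce G (axis i x)))"
  using continuous_map_compose[OF continuous_map_reduce_axis[OF assms(2)]
      continuous_map_into_fulltopology[OF assms(1)]]
  by (simp add: comp_def)

lemma quadratic_imp_gaussian: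
  assumes "quadratic G \<xi>"
  shows "\<exists>M C v. transpose M = M \<and> integral_on_period G M \<and>
    (\<forall>i. C $ i = M $ i $ i * factor_char (G i)) \<and> v \<in> carrier (bullet_group G) \<and>
    (\<forall>g \<in> carrier (elem_group G). \<xi> g = gaussian M C g * unit_exp (v \<bullet> g))"
proof -
  obtain B where \<xi>_cont: "continuous_map (group_topology G) (top_of_set (carrier U1)) \<xi>"
    and B: "bicharacter G B"
    and \<xi>_mult: "\<And>g h. g \<in> carrier (elem_group G) \<Longrightarrow> h \<in> carrier (elem_group G) \<Longrightarrow>
      \<xi> (g \<otimes>\<^bsub>elem_group G\<^esub> h) = \<xi> g * \<xi> h * B g h"
    using assms unfolding quadratic_def by blast
  have \<xi>_norm: "norm (\<xi> g) = 1" if "g \<in> carrier (elem_group G)" for g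
    using \<xi>_cont that unfolding continuous_map_in_subtopology
    by (auto simp: topspace_group_topology U1_def)
  have char: "is_character G (\<lambda>g. B g h)" if "h \<in> carrier (elem_group G)" for h
    using B that unfolding bicharacter_def by blast
  define b where "b x y = B (reduce G x) (reduce G y)" for x y
  have \<xi>_add: "\<xi> (reduce G (x + y)) = \<xi> (reduce G x) * \<xi> (reduce G y) * b x y"
    if "x \<in> cover G" "y \<in> cover G" for x y
    using that \<xi>_mult by (simp add: reduce_add b_def reduce_in_carrier)
  have b_add: "b (x + x') y = b x y * b x' y"
    if "x \<in> cover G" "x' \<in> cover G" "y \<in> cover G" for x x' y
    using char[OF reduce_in_carrier[OF that(3)]] reduce_in_carrier[OF that(1)]
      reduce_in_carrier[OF that(2)]
    by (simp add: b_def is_character_def hom_def U1_def reduce_add)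
  \<comment> \<open>The values of \<open>\<xi>\<close> are nonzero, so \<open>b x y\<close> is a
    quotient whose numerator and denominator are unchanged when \<open>x\<close> and
    \<open>y\<close> are swapped.\<close>
  have b_sym: "b x y = b y x" if "x \<in> cover G" "y \<in> cover G" for x y
  proof -
    have "\<xi> (reduce G x) \<noteq> 0" "\<xi> (reduce G y) \<noteq> 0"
      using \<xi>_norm[OF reduce_in_carrier] that by force+
    then show ?thesis
      using \<xi>_add[OF that] \<xi>_add[OF that(2,1)] by (simp add: add.commute)
  qed
  have b_norm: "norm (b x y) = 1" if "x \<in> cover G" "y \<in> cover G" for x y
    using char[OF reduce_in_carrier[OF that(2)]] reduce_in_carrier[OF that(1)]
    by (auto simp: b_def is_character_def hom_def U1_def)
  have b_cont: "continuous_on UNIV (\<lambda>x. b (axis i x) y)"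
    if "y \<in> cover G" "factor_cover (G i) = UNIV" for i y
    unfolding b_def using char[OF reduce_in_carrier[OF that(1)]] that(2)
    by (intro continuous_on_character_axis) (auto simp: is_character_def)
  obtain M :: "real ^ 'm ^ 'm" where sym: "transpose M = M"
    and M: "\<And>x y. x \<in> cover G \<Longrightarrow> y \<in> cover G \<Longrightarrow> b x y = unit_exp (x \<bullet> (M *v y))"
    using cover_bicharacter[of b] b_add b_sym b_norm b_cont by blast
  have int: "integral_on_period G M"
    unfolding integral_on_period_def
  proof (intro ballI)
    fix k x assume k: "k \<in> period G" and x: "x \<in> cover G"
    have "reduce G k = reduce G 0" using k by (simp add: reduce_eq_iff)
    then have "b k x = b 0 x" by (simp only: b_def)
    then have "unit_exp (k \<bullet> (M *v x)) = 1" using M[of k x] M[of 0 x] k x by (simp add: period_subset_cover)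
    then show "k \<bullet> (M *v x) \<in> \<int>" by (simp only: unit_exp_eq_1_iff)
  qed
  define C where "C = (\<chi> i. M $ i $ i * factor_char (G i))"
  have C: "C $ i = M $ i $ i * factor_char (G i)" for i by (simp add: C_def)
  \<comment> \<open>The lift of \<open>\<xi>\<close> and the Gaussian have the same multiplier
    \<open>b\<close>, so it cancels in the quotient and \<open>f\<close> is a character of the
    cover.\<close>
  define f where "f x = \<xi> (reduce G x) / gaussian M C x" for x
  have gaussian_nz [simp]: "gaussian M C x \<noteq> 0" for x by (simp add: gaussian_def)
  have "f (x + y) = f x * f y" if "x \<in> cover G" "y \<in> cover G" for x y
    using that by (simp add: f_def \<xi>_add gaussian_add[OF sym] M field_simps)
  moreover have "norm (f x) = 1" if "x \<in> cover G" for x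
    using \<xi>_norm[OF reduce_in_carrier[OF that]] by (simp add: f_def norm_divide)
  moreover have "continuous_on UNIV (\<lambda>x. f (axis i x))" if "factor_cover (G i) = UNIV" for i
  proof -
    have "continuous_on UNIV (axis i :: real \<Rightarrow> real ^ 'm)"
      unfolding axis_def
    proof (rule continuous_on_vec_lambda)
      show "continuous_on UNIV (\<lambda>x :: real. if j = i then x else 0)" for j
        by (cases "j = i") auto
    qed
    then show ?thesis
      unfolding f_def using that \<xi>_cont
      by (intro continuous_on_divide continuous_on_character_axis)
        (auto simp: gaussian_def intro!: continuous_intros)
  qed
  ultimately obtain w where w: "\<And>x. x \<in> cover G \<Longrightarrow> f x = unit_exp (w \<bullet> x)"
    using cover_character[of f] by blast
  \<comment> \<open>Both the lift of \<open>\<xi>\<close> and the Gaussian take the same value at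
    \<open>k\<close> as at 0, hence so does \<open>f\<close>.\<close>
  have w_period: "w \<bullet> k \<in> \<int>" if k: "k \<in> period G" for k
  proof -
    have "reduce G k = reduce G 0" using k by (simp add: reduce_eq_iff)
    moreover have "gaussian M C k = gaussian M C 0"
      using gaussian_period[OF sym int C] k by simp
    ultimately have "f k = f 0" by (simp only: f_def)
    then have "unit_exp (w \<bullet> k) = 1" using w[OF period_subset_cover[OF k]] w[of 0] by simp
    then show ?thesis by (simp only: unit_exp_eq_1_iff)
  qed
  \<comment> \<open>Integrality of \<open>w\<close> on the axis periods puts the reduced vector into
    the bullet group; by duality the reduction changes \<open>w \<bullet> g\<close> only by an
    integer.\<close>
  define v where "v = (\<chi> i. w $ i rmod bullet_char (G i))"
  have "v $ i \<in> bullet_carrier (G i)" for i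
    using w_period[OF period_axis[of i 1 G]]
    by (auto simp: v_def inner_axis mult.commute intro!: rmod_in_bullet_carrier)
  then have "v \<in> carrier (bullet_group G)" by (simp add: bullet_group_def residue_product_def)
  moreover have "\<xi> g = gaussian M C g * unit_exp (v \<bullet> g)" if "g \<in> carrier (elem_group G)" for g
  proof -
    have g: "g \<in> cover G" using that by (rule carrier_subset_cover)
    have "g $ i * (v $ i - w $ i) \<in> \<int>" for i
      using g by (intro dual_if_bullet_cong[where F = "G i"]) (auto simp: v_def rcong_def cover_def)
    then have "(\<Sum>i\<in>UNIV. g $ i * (v $ i - w $ i)) \<in> \<int>" by (intro Ints_sum)
    also have "(\<Sum>i\<in>UNIV. g $ i * (v $ i - w $ i)) = v \<bullet> g - w \<bullet> g"
      by (simp add: inner_vec_def algebra_simps sum_subtractf)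
    finally have "unit_exp (v \<bullet> g) = unit_exp (w \<bullet> g)" by (simp only: unit_exp_eq_iff)
    then show ?thesis using w[OF g] by (simp add: f_def reduce_carrier[OF that] field_simps)
  qed
  ultimately show ?thesis using sym int C by blast
qed

end

theorem theorem3:
  fixes G :: "'m::finite \<Rightarrow> factor" and \<xi> :: "real ^ 'm \<Rightarrow> complex"
  assumes "\<And>i N. G i = Cyclic N \<Longrightarrow> N \<ge> 1"
    and "\<xi> \<in> carrier (elem_group G) \<rightarrow> carrier U1"
  shows "quadratic G \<xi> \<longleftrightarrow>
    (\<exists>(M :: real ^ 'm ^ 'm) (C :: real ^ 'm) (v :: real ^ 'm).
       v \<in> carrier (bullet_group G) \<and>
       (\<exists>\<phi> \<in> hom (elem_group G) (bullet_group G). matrix_rep G M \<phi>) \<and>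
       transpose M = M \<and>
       (\<forall>i. C $ i \<in> \<int> \<and> C $ i = M $ i $ i * factor_char (G i)) \<and>
       (\<forall>g \<in> carrier (elem_group G).
          \<xi> g = exp (complex_of_real pi * \<i> *
                  complex_of_real (g \<bullet> (M *v g) + C \<bullet> g + 2 * (v \<bullet> g)))))"
proof -
  interpret valid_factors G by standard (rule assms(1))
  \<comment> \<open>Passing from \<open>exp\<close> to \<open>unit_exp\<close> halves the exponent:
    the half stays in the Gaussian, while it cancels the 2 in front of
    \<open>v \<bullet> g\<close>.\<close>
  have formula: "exp (complex_of_real pi * \<i> *
      complex_of_real (g \<bullet> (M *v g) + C \<bullet> g + 2 * (v \<bullet> g))) = gaussian M C g * unit_exp (v \<bullet> g)"
    for M :: "real ^ 'm ^ 'm" and C v g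
    unfolding exp_eq_unit_exp gaussian_def unit_exp_add[symmetric] by (simp add: add_divide_distrib)
  show ?thesis
    unfolding formula
  proof
    assume "quadratic G \<xi>"
    then obtain M C v where form: "transpose M = M" "integral_on_period G M"
      "\<And>i. C $ i = M $ i $ i * factor_char (G i)" "v \<in> carrier (bullet_group G)"
      "\<And>g. g \<in> carrier (elem_group G) \<Longrightarrow> \<xi> g = gaussian M C g * unit_exp (v \<bullet> g)"
      using quadratic_imp_gaussian by blast
    then show "\<exists>(M :: real ^ 'm ^ 'm) C v. v \<in> carrier (bullet_group G) \<and>
       (\<exists>\<phi> \<in> hom (elem_group G) (bullet_group G). matrix_rep G M \<phi>) \<and>
       transpose M = M \<and>
       (\<forall>i. C $ i \<in> \<int> \<and> C $ i = M $ i $ i * factor_char (G i)) \<and>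
       (\<forall>g \<in> carrier (elem_group G). \<xi> g = gaussian M C g * unit_exp (v \<bullet> g))"
      using C_Ints[OF form(1-3)] matrix_rep_iff[OF form(1)]
      by (intro exI[of _ M] exI[of _ C] exI[of _ v]) auto
  next
    assume "\<exists>(M :: real ^ 'm ^ 'm) C v. v \<in> carrier (bullet_group G) \<and>
       (\<exists>\<phi> \<in> hom (elem_group G) (bullet_group G). matrix_rep G M \<phi>) \<and>
       transpose M = M \<and>
       (\<forall>i. C $ i \<in> \<int> \<and> C $ i = M $ i $ i * factor_char (G i)) \<and>
       (\<forall>g \<in> carrier (elem_group G). \<xi> g = gaussian M C g * unit_exp (v \<bullet> g))"
    then show "quadratic G \<xi>" using quadratic_gaussian matrix_rep_iff by blast
  qed
qed

end
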